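(* Let $P$, $X$, $Y$ be metric spaces, $P\times X$ being equipped with the max distance, let $C\subset Y$ be a nonempty closed proper subset, let $F:P\times X\rightrightarrows Y$ be a set-valued mapping with $F(p,x)\neq\varnothing$ for all $(p,x)\in P\times X$, and let $\vartheta:P\times X\to\mathbb R$ be a function. For $p\in P$ let $S(p)=\{x\in X: F(p,x)\subseteq C\}$, $\mathrm{val}(p)=\inf_{x\in S(p)}\vartheta(p,x)$ and $\mathrm{Argmin}(p)=\{x\in S(p):\vartheta(p,x)\le\mathrm{val}(p)\}$, and let $\varphi_F(p,x)=\sup_{y\in F(p,x)}\mathrm{dist}(y,C)$. Let $\bar p\in P$ and $\bar x\in\mathrm{Argmin}(\bar p)$. Suppose that: (i) $(X,d)$ is metrically complete; (ii) the mapping $F(\cdot,\bar x):P\rightrightarrows Y$ is Lipschitz upper semicontinuous at $\bar p$; (iii) there exists $\delta>0$ such that, for every $p\in B(\bar p,\delta)$, the set-valued mapping $F(p,\cdot):X\rightrightarrows Y$ is lower semicontinuous on $X$; (iv) $\overline{|\nabla_x\varphi_F|}{}^{>}(\bar p,\bar x)>0$; (v) $\vartheta$ is calm from above at $(\bar p,\bar x)$. Then $\mathrm{val}:P\to\mathbb R\cup\{\pm\infty\}$ is calm from above at $\bar p$ and $$\overline{\mathrm{clm}}\,\mathrm{val}(\bar p)\le\overline{\mathrm{clm}}\,\vartheta(\bar p,\bar x)\cdot\max\left\{1,\ \frac{\mathrm{Lipusc}\,F(\cdot,\bar x)(\bar p)}{\overline{|\nabla_x\varphi_F|}{}^{>}(\bar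 p,\bar x)}\right\}.$$
   Context: All metrics are denoted $d$. $B(x,r)$ is the closed ball of center $x$ and radius $r$; $\mathrm{dist}(x,A)=\inf_{a\in A}d(x,a)$ ($=+\infty$ if $A=\varnothing$); $B(A,r)=\{x:\mathrm{dist}(x,A)\le r\}$. A set-valued mapping $\Phi:X\rightrightarrows Y$ between metric spaces is: - lower semicontinuous (l.s.c.) at $\bar x$ if for every open $O\subseteq Y$ with $\Phi(\bar x)\cap O\neq\varnothing$ there is a neighbourhood $U$ of $\bar x$ with $\Phi(x)\cap O\ne\varnothing$ for all $x\in U$; - Lipschitz upper semicontinuous at $\bar x$ if there are $\delta,\ell>0$ such that $\Phi(x)\subseteq B(\Phi(\bar x),\ell d(x,\bar x))$ for all $x\in B(\bar x,\delta)$; $\mathrm{Lipusc}\,\Phi(\bar x)$ is the infimum of all $\ell>0$ for which such a $\delta>0$ exists. A function $g:Z\to\mathbb R\cup\{\pm\infty\}$ on a metric space is calm from above at a point $\bar z$ with $g(\bar z)\in\mathbb R$ if there are $\delta,\ell>0$ such that $g(z)-g(\bar z)\le\ell d(z,\bar z)$ for all $z\in B(\bar z,\delta)$; $\overline{\mathrm{clm}}\,g(\bar z)$ is the infimum of all $\ell>0$ for which such a $\delta>0$ exists. The strong slope of $\psi:X\to\mathbb R\cup\{\pm\infty\}$ at a point $x$ with $\psi(x)\in\mathbb R$ is $|\nabla\psi|(x)=0$ if $x$ is a local minimizer of $\psi$, and $|\nabla\psi|(x)=\limsup_{z\to x}\frac{\psi(x)-\psi(z)}{d(z,x)}$ otherwise.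 The partial strict outer slope of $\varphi_F$ is $$\overline{|\nabla_x\varphi_F|}{}^{>}(\bar p,\bar x)=\lim_{\epsilon\to0^+}\inf\{|\nabla\varphi_F(p,\cdot)|(x):(p,x)\in B(\bar p,\epsilon)\times B(\bar x,\epsilon),\ \varphi_F(\bar p,\bar x)<\varphi_F(p,x)<\varphi_F(\bar p,\bar x)+\epsilon\},$$ with $\inf\varnothing=+\infty$; a finite number divided by $+\infty$ is $0$. *)

theory Defs
  imports "HOL-Analysis.Analysis"
begin

text \<open>Distance to a set with values in the extended reals, so that the distance to the empty set
  is \<open>\<infinity>\<close> (the library's \<open>infdist\<close> is real-valued and gives 0 there).\<close>

definition set_dist :: "'a::metric_space \<Rightarrow> 'a set \<Rightarrow> ereal" where
  "set_dist x A = (INF a\<in>A. ereal (dist x a))"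

definition set_cball :: "'a::metric_space set \<Rightarrow> real \<Rightarrow> 'a set" where
  "set_cball A r = {x. set_dist x A \<le> ereal r}"

text \<open>The metric that the library puts on a product type is the Euclidean one; the max distance is
  therefore a separate function.\<close>

definition max_dist :: "'a::metric_space \<times> 'b::metric_space \<Rightarrow> 'a \<times> 'b \<Rightarrow> real" where
  "max_dist z w = max (dist (fst z) (fst w)) (dist (snd z) (snd w))"

definition lsc_at :: "('a::topological_space \<Rightarrow> 'b::topological_space set) \<Rightarrow> 'a \<Rightarrow> bool" where
  "lsc_at \<Phi> a \<longleftrightarrow>
     (\<forall>V. open V \<longrightarrow> \<Phi> a \<inter> V \<noteq> {} \<longrightarrow> (\<forall>\<^sub>F x in nhds a. \<Phi> x \<inter> V \<noteq> {}))"

definition lip_usc_with :: "('a::metric_space \<Rightarrow> 'b::metric_space set) \<Rightarrow> 'a \<Rightarrow> real \<Rightarrow> bool" where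
  "lip_usc_with \<Phi> a l \<longleftrightarrow>
     (\<exists>\<delta>>0. \<forall>x\<in>cball a \<delta>. \<Phi> x \<subseteq> set_cball (\<Phi> a) (l * dist x a))"

definition lip_usc_at :: "('a::metric_space \<Rightarrow> 'b::metric_space set) \<Rightarrow> 'a \<Rightarrow> bool" where
  "lip_usc_at \<Phi> a \<longleftrightarrow> (\<exists>l>0. lip_usc_with \<Phi> a l)"

definition Lipusc :: "('a::metric_space \<Rightarrow> 'b::metric_space set) \<Rightarrow> 'a \<Rightarrow> ereal" where
  "Lipusc \<Phi> a = (INF l\<in>{l. l > 0 \<and> lip_usc_with \<Phi> a l}. ereal l)"

text \<open>In the calmness notions the distance is an explicit argument \<open>d\<close>, so that they can be used
  with \<open>max_dist\<close> on a product.\<close>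

definition calm_above_with ::
    "('z \<Rightarrow> 'z \<Rightarrow> real) \<Rightarrow> ('z \<Rightarrow> ereal) \<Rightarrow> 'z \<Rightarrow> real \<Rightarrow> bool" where
  "calm_above_with d g a l \<longleftrightarrow>
     (\<exists>\<delta>>0. \<forall>z. d z a \<le> \<delta> \<longrightarrow> g z - g a \<le> ereal (l * d z a))"

definition calm_above_at :: "('z \<Rightarrow> 'z \<Rightarrow> real) \<Rightarrow> ('z \<Rightarrow> ereal) \<Rightarrow> 'z \<Rightarrow> bool" where
  "calm_above_at d g a \<longleftrightarrow> \<bar>g a\<bar> \<noteq> \<infinity> \<and> (\<exists>l>0. calm_above_with d g a l)"

definition clm_above :: "('z \<Rightarrow> 'z \<Rightarrow> real) \<Rightarrow> ('z \<Rightarrow> ereal) \<Rightarrow> 'z \<Rightarrow> ereal" where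
  "clm_above d g a = (INF l\<in>{l. l > 0 \<and> calm_above_with d g a l}. ereal l)"

text \<open>The strong slope is meaningful only at points where \<open>\<psi>\<close> is finite. The filter \<open>at x\<close> excludes
  \<open>z = x\<close>, and it is nontrivial whenever \<open>x\<close> is not a local minimizer.\<close>

definition strong_slope :: "('a::metric_space \<Rightarrow> ereal) \<Rightarrow> 'a \<Rightarrow> ereal" where
  "strong_slope \<psi> x =
     (if \<forall>\<^sub>F z in nhds x. \<psi> x \<le> \<psi> z then 0
      else Limsup (at x) (\<lambda>z. (\<psi> x - \<psi> z) / ereal (dist z x)))"

text \<open>The infimum below is nonincreasing in \<open>\<epsilon>\<close>, hence the one-sided limit always exists.\<close>

definition partial_strict_outer_slope ::
    "('p::metric_space \<times> 'x::metric_space \<Rightarrow> ereal) \<Rightarrow> 'p \<Rightarrow> 'x \<Rightarrow> ereal" where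
  "partial_strict_outer_slope \<phi> pb xb =
     Lim (at_right 0) (\<lambda>\<epsilon>::real.
       INF (p, x)\<in>{(p, x). (p, x) \<in> cball pb \<epsilon> \<times> cball xb \<epsilon> \<and>
                            \<phi> (pb, xb) < \<phi> (p, x) \<and> \<phi> (p, x) < \<phi> (pb, xb) + ereal \<epsilon>}.
         strong_slope (\<lambda>u. \<phi> (p, u)) x)"

definition feasible_set :: "('p \<times> 'x \<Rightarrow> 'y set) \<Rightarrow> 'y set \<Rightarrow> 'p \<Rightarrow> 'x set" where
  "feasible_set F C p = {x. F (p, x) \<subseteq> C}"

definition val :: "('p \<times> 'x \<Rightarrow> 'y set) \<Rightarrow> 'y set \<Rightarrow> ('p \<times> 'x \<Rightarrow> real) \<Rightarrow> 'p \<Rightarrow> ereal" where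
  "val F C \<theta> p = (INF x\<in>feasible_set F C p. ereal (\<theta> (p, x)))"

definition Argmin :: "('p \<times> 'x \<Rightarrow> 'y set) \<Rightarrow> 'y set \<Rightarrow> ('p \<times> 'x \<Rightarrow> real) \<Rightarrow> 'p \<Rightarrow> 'x set" where
  "Argmin F C \<theta> p = {x \<in> feasible_set F C p. ereal (\<theta> (p, x)) \<le> val F C \<theta> p}"

definition excess_fun :: "('p \<times> 'x \<Rightarrow> 'y::metric_space set) \<Rightarrow> 'y set \<Rightarrow> 'p \<times> 'x \<Rightarrow> ereal" where
  "excess_fun F C z = (SUP y\<in>F z. set_dist y C)"

end

theory Submission
  imports Defs
begin

text \<open>For \<open>p\<close> near \<open>pb\<close>, Lipschitz upper semicontinuity bounds \<open>excess_fun F C (p, xb)\<close> by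
  \<open>L * dist p pb\<close>. Ekeland's principle applied to the lower semicontinuous function
  \<open>excess_fun F C (p, \<cdot>)\<close> at \<open>xb\<close> with slope \<open>\<sigma>\<close> yields a point within \<open>(L / \<sigma>) * dist p pb\<close> of \<open>xb\<close>
  whose strong slope is at most \<open>\<sigma>\<close>. If \<open>\<sigma>\<close> is below the strict outer slope, the excess there must
  vanish, so the point is feasible for \<open>p\<close>, and calmness of \<open>\<theta>\<close> bounds \<open>val F C \<theta> p\<close>. Finally let \<open>L\<close>,
  \<open>\<sigma>\<close> and the calmness constant tend to their extremal values.\<close>

section \<open>Ekeland's variational principle\<close>

lemma closed_sublevels_lim_le:
  fixes f :: "'a::topological_space \<Rightarrow> real"
  assumes lsc: "\<And>c. closed {x. f x \<le> c}"
    and z: "z \<longlonglongrightarrow> a" and b: "b \<longlonglongrightarrow> B"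
    and le: "\<forall>\<^sub>F n in sequentially. f (z n) \<le> b n"
  shows "f a \<le> B"
\<comment> \<open>The slack \<open>e\<close> puts a tail of \<open>z\<close> into the single closed
  sublevel set at height \<open>B + e\<close>, although the bounds \<open>b n\<close> vary.\<close>
proof (rule field_le_epsilon)
  fix e :: real assume "e > 0"
  then have "\<forall>\<^sub>F n in sequentially. b n < B + e"
    using order_tendstoD(2)[OF b, of "B + e"] by simp
  with le have "\<forall>\<^sub>F n in sequentially. z n \<in> {x. f x \<le> B + e}"
    by eventually_elim simp
  from Lim_in_closed_set[OF lsc this _ z] show "f a \<le> B + e" by simp
qed

text \<open>Follow the order "\<open>v\<close> lies in \<open>S u\<close>" downwards, nearly
  minimizing \<open>f\<close> at each step. Every descent in this order pays for the distance
  travelled, so the sequence converges, and its limit \<open>a\<close> satisfies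
  \<open>S a = {a}\<close>, which is the strict inequality.\<close>

theorem ekeland:
  fixes f :: "'a::metric_space \<Rightarrow> real"
  assumes compl: "complete (UNIV :: 'a set)"
    and lsc: "\<And>c. closed {x. f x \<le> c}"
    and bdd: "\<And>x. m \<le> f x"
    and s: "s > 0"
  obtains x where "f x + s * dist x x0 \<le> f x0"
    and "\<And>z. z \<noteq> x \<Longrightarrow> f x < f z + s * dist z x"
proof -
  define S where "S u = {z. f z + s * dist z u \<le> f u}" for u
  have S_refl: "u \<in> S u" for u by (simp add: S_def)
  have S_trans: "w \<in> S u" if "w \<in> S v" "v \<in> S u" for u v w
  proof -
    have "s * dist w u \<le> s * dist w v + s * dist v u"
      using s dist_triangle[of w u v] by (simp flip: distrib_left)
    with that show ?thesis by (simp add: S_def)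
  qed
  have bdd_S: "bdd_below (f ` S u)" for u by (rule bdd_belowI2[of _ m]) (simp add: bdd)
  have step: "\<exists>v\<in>S u. f v \<le> Inf (f ` S u) + e" if "e > 0" for u e
  proof -
    have "\<exists>y\<in>f ` S u. y < Inf (f ` S u) + e"
      using S_refl[of u] that by (intro cInf_lessD) auto
    then show ?thesis by (auto intro: less_imp_le)
  qed
  \<comment> \<open>The guarded conjunct pins the start of the dependent choice to
    \<open>x0\<close>. The tolerance \<open>(1/2)^n\<close> only has to be positive and tend to
    0.\<close>
  have "\<exists>x. \<forall>n. (n = 0 \<longrightarrow> x n = x0) \<and>
      x (Suc n) \<in> S (x n) \<and> f (x (Suc n)) \<le> Inf (f ` S (x n)) + (1/2)^n"
  proof (rule dependent_nat_choice)
    show "\<exists>v. (0::nat) = 0 \<longrightarrow> v = x0" by blast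
    show "\<exists>v. (Suc n = 0 \<longrightarrow> v = x0) \<and> v \<in> S u \<and> f v \<le> Inf (f ` S u) + (1/2)^n" for n u
      using step[of "(1/2)^n" u] by auto
  qed
  then obtain x where x0: "x 0 = x0" and xS: "\<And>n. x (Suc n) \<in> S (x n)"
    and xI: "\<And>n. f (x (Suc n)) \<le> Inf (f ` S (x n)) + (1/2)^n" by blast
  have chain: "x k \<in> S (x n)" if "n \<le> k" for n k
    using that by (induction rule: dec_induct) (auto intro: S_refl S_trans[OF xS])
  have decf: "decseq (\<lambda>n. f (x n))"
  proof (rule decseq_SucI)
    fix n
    have "0 \<le> s * dist (x (Suc n)) (x n)" using s by simp
    then show "f (x (Suc n)) \<le> f (x n)" using xS[of n] by (simp add: S_def)
  qed
  have "convergent (\<lambda>n. f (x n))"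
    using decseq_convergent[OF decf, of m] bdd by (metis convergentI)
  then have CF: "Cauchy (\<lambda>n. f (x n))" by (rule convergent_Cauchy)
  have "Cauchy x"
  proof (rule metric_CauchyI)
    fix e :: real assume "e > 0"
    then obtain M where M: "\<And>i j. i \<ge> M \<Longrightarrow> j \<ge> M \<Longrightarrow> dist (f (x i)) (f (x j)) < s * e"
      using metric_CauchyD[OF CF, of "s * e"] s by auto
    \<comment> \<open>Membership of \<open>x j\<close> in \<open>S (x i)\<close> bounds
      \<open>s\<close> times the distance by the drop of \<open>f\<close>, so \<open>x\<close>
      inherits the Cauchy property from the values.\<close>
    have *: "dist (x j) (x i) < e" if "M \<le> i" "i \<le> j" for i j
    proof -
      have "s * dist (x j) (x i) < s * e"
        using chain[OF that(2)] M[of i j] that by (simp add: S_def dist_real_def)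
      then show ?thesis using s by simp
    qed
    show "\<exists>M. \<forall>i\<ge>M. \<forall>j\<ge>M. dist (x i) (x j) < e"
      using * by (metis dist_commute nle_le)
  qed
  then obtain a where a: "x \<longlonglongrightarrow> a"
    using compl unfolding complete_def by blast
  have aS: "a \<in> S (x n)" for n
  proof -
    have "f a \<le> f (x n) - s * dist a (x n)"
    proof (rule closed_sublevels_lim_le[OF lsc a])
      show "(\<lambda>k. f (x n) - s * dist (x k) (x n)) \<longlonglongrightarrow> f (x n) - s * dist a (x n)"
        by (intro tendsto_intros a)
      show "\<forall>\<^sub>F k in sequentially. f (x k) \<le> f (x n) - s * dist (x k) (x n)"
        using eventually_ge_at_top[of n]
        by eventually_elim (use chain in \<open>auto simp: S_def algebra_simps\<close>)
    qed
    then show ?thesis by (simp add: S_def)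
  qed
  \<comment> \<open>By transitivity \<open>w\<close> lies in every \<open>S (x n)\<close>, so
    \<open>f w\<close> is at least the infimum that \<open>x (Suc n)\<close> attains up to
    \<open>(1/2)^n\<close>. Hence \<open>x\<close> converges to \<open>w\<close> as well.\<close>
  have uniq: "w = a" if "w \<in> S a" for w
  proof -
    have le: "s * dist (x (Suc n)) w \<le> (1/2)^n" for n
    proof -
      have "w \<in> S (x n)" "w \<in> S (x (Suc n))" using S_trans that aS by blast+
      then have "Inf (f ` S (x n)) \<le> f w" and "s * dist w (x (Suc n)) \<le> f (x (Suc n)) - f w"
        using cInf_lower[OF _ bdd_S] by (auto simp: S_def[of "x (Suc n)"])
      with xI[of n] show ?thesis by (simp add: dist_commute)
    qed
    have "(\<lambda>n. s * dist (x (Suc n)) w) \<longlonglongrightarrow> s * dist a w"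
      by (intro tendsto_intros LIMSEQ_Suc a)
    moreover have "(\<lambda>n. (1/2::real)^n) \<longlonglongrightarrow> 0" by (rule LIMSEQ_realpow_zero) auto
    ultimately have "s * dist a w \<le> 0" using le by (intro LIMSEQ_le) auto
    then show ?thesis using s by (simp add: mult_le_0_iff)
  qed
  show thesis
  proof (rule that[of a])
    show "f a + s * dist a x0 \<le> f x0" using aS[of 0] x0 by (simp add: S_def)
    show "f a < f z + s * dist z a" if "z \<noteq> a" for z
      using uniq[of z] that by (force simp: S_def)
  qed
qed

text \<open>Truncation at the finite height \<open>f x0\<close> gives a real function. Sublevel sets
  below that height are unchanged and the others become the whole space, so lower semicontinuity
  survives.\<close>

corollary ekeland_ereal:
  fixes f :: "'a::metric_space \<Rightarrow> ereal"
  assumes compl: "complete (UNIV :: 'a set)"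
    and lsc: "\<And>c. closed {x. f x \<le> c}"
    and nn: "\<And>x. 0 \<le> f x"
    and fin: "f x0 \<noteq> \<infinity>"
    and s: "s > 0"
  obtains x where "f x + ereal (s * dist x x0) \<le> f x0"
    and "\<And>z. z \<noteq> x \<Longrightarrow> f x < f z + ereal (s * dist z x)"
proof -
  define g where "g x = real_of_ereal (min (f x) (f x0))" for x
  obtain b where b: "f x0 = ereal b" using fin nn[of x0] by (cases "f x0") auto
  have g: "ereal (g x) = min (f x) (f x0)" for x
    using nn[of x] nn[of x0] b by (cases "f x") (auto simp: g_def min_def)
  have gx0: "g x0 = b" using g[of x0] b by simp
  have "closed {x. g x \<le> c}" for c
  proof (cases "b \<le> c")
    case True
    have "g x \<le> b" for x
      using g[of x] b by (metis ereal_less_eq(3) min.cobounded2)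
    with True have "{x. g x \<le> c} = UNIV" by (auto intro: order_trans)
    then show ?thesis by simp
  next
    case False
    have "g x \<le> c \<longleftrightarrow> f x \<le> ereal c" for x
      using False b g[of x] by (simp flip: ereal_less_eq(3) add: min_le_iff_disj)
    then show ?thesis using lsc by simp
  qed
  moreover have "0 \<le> g x" for x using nn by (simp add: g_def real_of_ereal_pos)
  ultimately obtain x where x: "g x + s * dist x x0 \<le> g x0"
    and min: "\<And>z. z \<noteq> x \<Longrightarrow> g x < g z + s * dist z x"
    using ekeland[OF compl _ _ s] by metis
  \<comment> \<open>Away from \<open>x0\<close> the term \<open>s * dist x x0\<close> is positive,
    which forces \<open>g x\<close> strictly below the truncation height.\<close>
  have "f x = ereal (g x)"
  proof (cases "x = x0")
    case False
    then have "s * dist x x0 > 0" using s by simp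
    then have "ereal (g x) < f x0" using x gx0 b by simp
    with g[of x] show ?thesis by (auto simp: min_def split: if_splits)
  qed (simp add: b gx0)
  note fx = this
  show thesis
  proof (rule that[of x])
    show "f x + ereal (s * dist x x0) \<le> f x0" using x by (simp add: fx b gx0)
    show "f x < f z + ereal (s * dist z x)" if "z \<noteq> x" for z
    proof -
      have "f x < ereal (g z) + ereal (s * dist z x)" using min[OF that] by (simp add: fx)
      also have "\<dots> \<le> f z + ereal (s * dist z x)"
        using g[of z] by (intro add_right_mono) simp
      finally show ?thesis .
    qed
  qed
qed

section \<open>Strong slopes and the strict outer slope\<close>

text \<open>The strict inequality has the form delivered by Ekeland's principle and bounds every
  difference quotient by \<open>s\<close>. For a local minimizer the slope is 0, whence
  \<open>s \<ge> 0\<close>.\<close>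

lemma strong_slope_le:
  assumes fin: "\<bar>\<psi> x\<bar> \<noteq> \<infinity>" and s: "s \<ge> 0"
    and min: "\<And>z. z \<noteq> x \<Longrightarrow> \<psi> x < \<psi> z + ereal (s * dist z x)"
  shows "strong_slope \<psi> x \<le> ereal s"
proof -
  have "(\<psi> x - \<psi> z) / ereal (dist z x) \<le> ereal s" if "z \<noteq> x" for z
    using min[OF that] fin that
    by (cases "\<psi> x"; cases "\<psi> z") (auto simp: divide_simps)
  then have "\<forall>\<^sub>F z in at x. (\<psi> x - \<psi> z) / ereal (dist z x) \<le> ereal s"
    by (simp add: eventually_at_filter)
  then show ?thesis using s by (auto simp: strong_slope_def intro: Limsup_bounded)
qed

lemma Lim_at_right_0_antimono:
  fixes f :: "real \<Rightarrow> ereal"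
  assumes "\<And>a b. 0 < a \<Longrightarrow> a \<le> b \<Longrightarrow> f b \<le> f a"
  shows "Lim (at_right 0) f = (SUP e\<in>{0<..}. f e)"
proof (rule tendsto_Lim)
  show "(f \<longlongrightarrow> (SUP e\<in>{0<..}. f e)) (at_right 0)"
  proof (rule order_tendstoI)
    fix a assume "a < (SUP e\<in>{0<..}. f e)"
    then obtain e0 where e0: "e0 > 0" "a < f e0" by (auto simp: less_SUP_iff)
    have "\<forall>\<^sub>F e in at_right (0::real). 0 < e \<and> e < e0"
      using e0(1) eventually_at_right_field by auto
    then show "\<forall>\<^sub>F e in at_right 0. a < f e"
      by eventually_elim (use assms e0(2) in \<open>meson less_imp_le less_le_trans\<close>)
  next
    fix a assume a: "(SUP e\<in>{0<..}. f e) < a"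
    have "\<forall>\<^sub>F e in at_right (0::real). e > 0" by (rule eventually_at_right_less)
    then show "\<forall>\<^sub>F e in at_right 0. f e < a"
      by eventually_elim (use a in \<open>auto intro: le_less_trans[OF SUP_upper]\<close>)
  qed
qed simp

text \<open>The infima grow as the region shrinks, so their limit is a supremum over
  \<open>e > 0\<close>, and a number strictly below it is already exceeded for one single
  \<open>e\<close>.\<close>

lemma less_partial_strict_outer_slopeD:
  assumes "s < partial_strict_outer_slope \<phi> pb xb"
  obtains e :: real where "e > 0"
    and "\<And>p x. dist p pb \<le> e \<Longrightarrow> dist x xb \<le> e \<Longrightarrow> \<phi> (pb, xb) < \<phi> (p, x) \<Longrightarrow>
           \<phi> (p, x) < \<phi> (pb, xb) + ereal e \<Longrightarrow> s < strong_slope (\<lambda>u. \<phi> (p, u)) x"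
proof -
  define D where "D e = {(p, x). (p, x) \<in> cball pb e \<times> cball xb e \<and>
    \<phi> (pb, xb) < \<phi> (p, x) \<and> \<phi> (p, x) < \<phi> (pb, xb) + ereal e}" for e
  define f where "f e = (INF (p, x)\<in>D e. strong_slope (\<lambda>u. \<phi> (p, u)) x)" for e
  have D_mono: "D a \<subseteq> D b" if "a \<le> b" for a b
  proof -
    have "\<phi> (pb, xb) + ereal a \<le> \<phi> (pb, xb) + ereal b"
      using that by (intro add_left_mono) simp
    then show ?thesis using that by (auto simp: D_def intro: less_le_trans)
  qed
  have "partial_strict_outer_slope \<phi> pb xb = Lim (at_right 0) f"
    unfolding partial_strict_outer_slope_def f_def D_def by (rule refl)
  also have "\<dots> = (SUP e\<in>{0<..}. f e)"
    by (rule Lim_at_right_0_antimono) (auto simp: f_def intro!: INF_superset_mono D_mono)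
  finally obtain e where e: "e > 0" "s < f e" using assms by (auto simp: less_SUP_iff)
  show thesis
  proof (rule that[OF e(1)])
    fix p x
    assume "dist p pb \<le> e" "dist x xb \<le> e" "\<phi> (pb, xb) < \<phi> (p, x)"
      "\<phi> (p, x) < \<phi> (pb, xb) + ereal e"
    then have "(p, x) \<in> D e" by (simp add: D_def dist_commute)
    then have "f e \<le> strong_slope (\<lambda>u. \<phi> (p, u)) x"
      unfolding f_def by (rule INF_lower2) simp
    with e(2) show "s < strong_slope (\<lambda>u. \<phi> (p, u)) x" by (rule less_le_trans)
  qed
qed

section \<open>The excess of \<open>F\<close> over \<open>C\<close>\<close>

lemma set_dist_eq_infdist:
  assumes "A \<noteq> {}"
  shows "set_dist x A = ereal (infdist x A)"
proof (rule antisym)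
  show "ereal (infdist x A) \<le> set_dist x A"
    unfolding set_dist_def by (auto intro!: INF_greatest infdist_le)
  show "set_dist x A \<le> ereal (infdist x A)"
  proof (rule ereal_le_epsilon2)
    fix e :: real assume "e > 0"
    then obtain a where "a \<in> A" "dist x a < infdist x A + e"
      using cInf_lessD[of "dist x ` A" "infdist x A + e"] assms
      by (auto simp: infdist_notempty)
    then show "set_dist x A \<le> ereal (infdist x A) + ereal e"
      unfolding set_dist_def by (auto intro!: INF_lower2)
  qed
qed

lemma excess_fun_le_iff: "excess_fun F C z \<le> c \<longleftrightarrow> (\<forall>y\<in>F z. set_dist y C \<le> c)"
  by (simp add: excess_fun_def SUP_le_iff)

lemma excess_fun_nonneg:
  assumes "F z \<noteq> {}"
  shows "0 \<le> excess_fun F C z"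
proof -
  obtain y where "y \<in> F z" using assms by blast
  moreover have "0 \<le> set_dist y C" by (auto simp: set_dist_def intro: INF_greatest)
  ultimately show ?thesis unfolding excess_fun_def by (meson SUP_upper2)
qed

lemma excess_fun_le_0_iff:
  assumes "closed C" "C \<noteq> {}"
  shows "excess_fun F C z \<le> 0 \<longleftrightarrow> F z \<subseteq> C"
proof -
  have "set_dist y C \<le> 0 \<longleftrightarrow> y \<in> C" for y
    using assms in_closed_iff_infdist_zero[of C y] infdist_nonneg[of y C]
    by (auto simp: set_dist_eq_infdist)
  then show ?thesis by (auto simp: excess_fun_le_iff)
qed

text \<open>The complement consists of the points \<open>x\<close> whose image meets the open set of
  all \<open>y\<close> at distance more than \<open>c\<close> from \<open>C\<close>; lower
  semicontinuity of \<open>F (p, \<cdot>)\<close> makes it open.\<close>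

lemma closed_excess_fun_le:
  assumes C: "C \<noteq> {}" and lsc: "\<And>x. lsc_at (\<lambda>u. F (p, u)) x"
  shows "closed {x. excess_fun F C (p, x) \<le> c}"
proof -
  define V where "V = {y. c < set_dist y C}"
  have "open V" unfolding V_def set_dist_eq_infdist[OF C]
    by (intro open_Collect_less continuous_intros)
  then have "\<forall>\<^sub>F u in nhds x. F (p, u) \<inter> V \<noteq> {}" if "F (p, x) \<inter> V \<noteq> {}" for x
    using lsc[of x] that by (simp add: lsc_at_def)
  then have "open {x. F (p, x) \<inter> V \<noteq> {}}"
    by (subst open_subopen) (simp add: eventually_nhds subset_eq)
  moreover have "- {x. excess_fun F C (p, x) \<le> c} = {x. F (p, x) \<inter> V \<noteq> {}}"
    by (auto simp: excess_fun_le_iff V_def not_le)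
  ultimately show ?thesis by (simp add: closed_def)
qed

text \<open>As \<open>F (pb, xb)\<close> lies in \<open>C\<close>, the distance to \<open>C\<close>
  never exceeds the distance to \<open>F (pb, xb)\<close>.\<close>

lemma excess_fun_le_lip_usc:
  assumes "F (pb, xb) \<subseteq> C" "F (p, xb) \<subseteq> set_cball (F (pb, xb)) r"
  shows "excess_fun F C (p, xb) \<le> ereal r"
proof -
  have "set_dist y C \<le> set_dist y (F (pb, xb))" for y
    using assms(1) unfolding set_dist_def by (intro INF_superset_mono) auto
  then show ?thesis
    using assms(2) by (auto simp: excess_fun_le_iff set_cball_def intro: order_trans)
qed

section \<open>Feasible points for perturbed parameters\<close>

lemma feasible_point_near:
  fixes F :: "'p::metric_space \<times> 'x::metric_space \<Rightarrow> 'y::metric_space set"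
  assumes C: "C \<noteq> {}" "closed C"
    and F_nonempty: "\<And>p x. F (p, x) \<noteq> {}"
    and feas: "F (pb, xb) \<subseteq> C"
    and compl: "complete (UNIV :: 'x set)"
    and usc: "lip_usc_with (\<lambda>p. F (p, xb)) pb L" and L: "L > 0"
    and lsc: "\<exists>\<delta>>0. \<forall>p\<in>cball pb \<delta>. \<forall>x. lsc_at (\<lambda>u. F (p, u)) x"
    and s: "s > 0" "ereal s < partial_strict_outer_slope (excess_fun F C) pb xb"
  obtains \<delta> where "\<delta> > 0"
    and "\<And>p. dist p pb \<le> \<delta> \<Longrightarrow>
           \<exists>x\<in>feasible_set F C p. dist x xb \<le> L / s * dist p pb"
proof -
  let ?\<phi> = "excess_fun F C"
  have nonneg: "0 \<le> ?\<phi> (p, x)" for p x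
    using F_nonempty by (rule excess_fun_nonneg)
  have \<phi>0: "?\<phi> (pb, xb) = 0"
    using nonneg excess_fun_le_0_iff[OF C(2,1)] feas
    by (metis antisym)
  obtain d1 where d1: "d1 > 0" "\<And>p. dist p pb \<le> d1 \<Longrightarrow>
      F (p, xb) \<subseteq> set_cball (F (pb, xb)) (L * dist p pb)"
    using usc by (auto simp: lip_usc_with_def dist_commute)
  obtain d2 where d2: "d2 > 0" "\<And>p x. dist p pb \<le> d2 \<Longrightarrow> lsc_at (\<lambda>u. F (p, u)) x"
    using lsc by (auto simp: dist_commute)
  obtain e where e: "e > 0" "\<And>p x. dist p pb \<le> e \<Longrightarrow> dist x xb \<le> e \<Longrightarrow> 0 < ?\<phi> (p, x) \<Longrightarrow>
      ?\<phi> (p, x) < ereal e \<Longrightarrow> ereal s < strong_slope (\<lambda>u. ?\<phi> (p, u)) x"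
    using less_partial_strict_outer_slopeD[OF s(2)] \<phi>0 by auto
  \<comment> \<open>The bound \<open>e / (2 * L)\<close> keeps the excess at \<open>xb\<close> at
    most \<open>e / 2\<close>, hence strictly below \<open>e\<close>; the bound
    \<open>e * s / L\<close> keeps the Ekeland point within \<open>e\<close> of \<open>xb\<close>.
    Both are needed to enter the region of the outer slope.\<close>
  define \<delta> where "\<delta> = Min {d1, d2, e, e / (2 * L), e * s / L}"
  have \<delta>: "\<delta> > 0" using d1 d2 e L s by (simp add: \<delta>_def)
  show thesis
  proof (rule that[OF \<delta>])
    fix p assume "dist p pb \<le> \<delta>"
    then have p: "dist p pb \<le> d1" "dist p pb \<le> d2" "dist p pb \<le> e"
      "L * dist p pb \<le> e / 2" "L / s * dist p pb \<le> e"
      using L s by (auto simp: \<delta>_def field_simps)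
    let ?f = "\<lambda>u. ?\<phi> (p, u)"
    have fxb: "?f xb \<le> ereal (L * dist p pb)"
      using excess_fun_le_lip_usc[OF feas d1(2)[OF p(1)]] .
    then have "?f xb \<noteq> \<infinity>" by auto
    with ekeland_ereal[of ?f, OF compl closed_excess_fun_le[OF C(1) d2(2)[OF p(2)]]
        nonneg _ s(1)]
    obtain x where x: "?f x + ereal (s * dist x xb) \<le> ?f xb"
      and min: "\<And>z. z \<noteq> x \<Longrightarrow> ?f x < ?f z + ereal (s * dist z x)" by metis
    from order_trans[OF x fxb] nonneg[of p x]
    obtain a where a: "?f x = ereal a" "0 \<le> a" "a + s * dist x xb \<le> L * dist p pb"
      by (cases "?f x") auto
    have "s * dist x xb \<ge> 0" using s by simp
    with a e(1) p(4) have ae: "a < e" by linarith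
    have dx: "dist x xb \<le> L / s * dist p pb" using a s by (simp add: field_simps)
    \<comment> \<open>A positive excess would put \<open>(p, x)\<close> into the region where the
      slope exceeds \<open>s\<close>, while the Ekeland inequality caps it by
      \<open>s\<close>.\<close>
    have "a = 0"
    proof (rule ccontr)
      assume "a \<noteq> 0"
      then have "ereal s < strong_slope ?f x" using a ae p dx by (intro e(2)) auto
      moreover have "strong_slope ?f x \<le> ereal s"
        using a s min by (intro strong_slope_le) auto
      ultimately show False by simp
    qed
    then have "F (p, x) \<subseteq> C" using excess_fun_le_0_iff[OF C(2,1), of F "(p, x)"] a by simp
    then show "\<exists>x\<in>feasible_set F C p. dist x xb \<le> L / s * dist p pb"
      using dx by (auto simp: feasible_set_def)
  qed
qed

section \<open>Calmness of the value function\<close>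

theorem proposition4p1:
  fixes F :: "'p::metric_space \<times> 'x::metric_space \<Rightarrow> 'y::metric_space set"
    and C :: "'y set"
    and \<theta> :: "'p \<times> 'x \<Rightarrow> real"
    and pb :: 'p and xb :: 'x
  assumes C: "C \<noteq> {}" "closed C" "C \<noteq> UNIV"
    and F_nonempty: "\<And>p x. F (p, x) \<noteq> {}"
    and xb: "xb \<in> Argmin F C \<theta> pb"
    and i: "complete (UNIV :: 'x set)"
    and ii: "lip_usc_at (\<lambda>p. F (p, xb)) pb"
    and iii: "\<exists>\<delta>>0. \<forall>p\<in>cball pb \<delta>. \<forall>x. lsc_at (\<lambda>u. F (p, u)) x"
    and iv: "partial_strict_outer_slope (excess_fun F C) pb xb > 0"
    and v: "calm_above_at max_dist (\<lambda>z. ereal (\<theta> z)) (pb, xb)"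
  shows "calm_above_at dist (val F C \<theta>) pb \<and>
    clm_above dist (val F C \<theta>) pb
      \<le> clm_above max_dist (\<lambda>z. ereal (\<theta> z)) (pb, xb) *
        max 1 (Lipusc (\<lambda>p. F (p, xb)) pb / partial_strict_outer_slope (excess_fun F C) pb xb)"
proof -
  let ?S = "partial_strict_outer_slope (excess_fun F C) pb xb"
  let ?M = "clm_above dist (val F C \<theta>) pb"
  let ?c = "clm_above max_dist (\<lambda>z. ereal (\<theta> z)) (pb, xb)"
  let ?K = "Lipusc (\<lambda>p. F (p, xb)) pb"
  have feas: "F (pb, xb) \<subseteq> C" and argmin: "ereal (\<theta> (pb, xb)) \<le> val F C \<theta> pb"
    using xb by (auto simp: Argmin_def feasible_set_def)
  have val_le: "val F C \<theta> p \<le> ereal (\<theta> (p, x))" if "x \<in> feasible_set F C p" for p x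
    using that by (auto simp: val_def intro: INF_lower)
  have val_pb: "val F C \<theta> pb = ereal (\<theta> (pb, xb))"
    using argmin val_le[of xb pb] feas by (auto simp: feasible_set_def)
  have calm: "calm_above_with dist (val F C \<theta>) pb (l * max 1 (L / s))"
    if l: "l > 0" "calm_above_with max_dist (\<lambda>z. ereal (\<theta> z)) (pb, xb) l"
      and L: "L > 0" "lip_usc_with (\<lambda>p. F (p, xb)) pb L"
      and s: "s > 0" "ereal s < ?S" for l L s
  proof -
    obtain d where d: "d > 0" "\<And>p x. max (dist p pb) (dist x xb) \<le> d \<Longrightarrow>
        \<theta> (p, x) - \<theta> (pb, xb) \<le> l * max (dist p pb) (dist x xb)"
      using l(2) by (auto simp: calm_above_with_def max_dist_def)
    obtain \<delta> where \<delta>: "\<delta> > 0" "\<And>p. dist p pb \<le> \<delta> \<Longrightarrow>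
        \<exists>x\<in>feasible_set F C p. dist x xb \<le> L / s * dist p pb"
      using feasible_point_near[OF C(1,2) F_nonempty feas i L(2,1) iii s] by metis
    define k where "k = max 1 (L / s)"
    have k: "k \<ge> 1" "L / s \<le> k" by (auto simp: k_def)
    show ?thesis
      unfolding calm_above_with_def k_def[symmetric]
    \<comment> \<open>The feasible point may be \<open>k\<close> times as far away as
      \<open>p\<close> in the max distance, so the radius \<open>d\<close> for
      \<open>\<theta>\<close> is divided by \<open>k\<close>.\<close>
    proof (intro exI[of _ "min \<delta> (d / k)"] conjI allI impI)
      show "min \<delta> (d / k) > 0" using \<delta> d k by simp
      fix p assume "dist p pb \<le> min \<delta> (d / k)"
      then have p: "dist p pb \<le> \<delta>" "k * dist p pb \<le> d" using k by (auto simp: field_simps)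
      obtain x where x: "x \<in> feasible_set F C p" "dist x xb \<le> L / s * dist p pb"
        using \<delta>(2)[OF p(1)] by blast
      have le: "max (dist p pb) (dist x xb) \<le> k * dist p pb"
        using k x(2) mult_right_mono[OF k(1), of "dist p pb"]
          mult_right_mono[OF k(2), of "dist p pb"] by auto
      have "\<theta> (p, x) - \<theta> (pb, xb) \<le> l * max (dist p pb) (dist x xb)"
        using le p(2) by (intro d(2)) auto
      also have "\<dots> \<le> l * (k * dist p pb)" using le l(1) by (intro mult_left_mono) auto
      finally have "ereal (\<theta> (p, x)) - ereal (\<theta> (pb, xb)) \<le> ereal (l * k * dist p pb)"
        by (simp add: mult.assoc)
      moreover have "val F C \<theta> p - val F C \<theta> pb \<le> ereal (\<theta> (p, x)) - ereal (\<theta> (pb, xb))"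
        using val_le[OF x(1)] by (simp only: val_pb ereal_minus_mono)
      ultimately show "val F C \<theta> p - val F C \<theta> pb \<le> ereal (l * k * dist p pb)"
        by (rule order_trans[rotated])
    qed
  qed
  obtain l0 where l0: "l0 > 0" "calm_above_with max_dist (\<lambda>z. ereal (\<theta> z)) (pb, xb) l0"
    using v by (auto simp: calm_above_at_def)
  obtain L0 where L0: "L0 > 0" "lip_usc_with (\<lambda>p. F (p, xb)) pb L0"
    using ii by (auto simp: lip_usc_at_def)
  obtain s0 where s0: "s0 > 0" "ereal s0 < ?S"
    using ereal_dense2[OF iv] by auto
  have "calm_above_at dist (val F C \<theta>) pb"
    unfolding calm_above_at_def using calm[OF l0 L0 s0] l0
    by (auto simp: val_pb intro!: exI[of _ "l0 * max 1 (L0 / s0)"] mult_pos_pos)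
  moreover have "?M \<le> ?c * max 1 (?K / ?S)"
  proof -
    \<comment> \<open>Strict inequalities for \<open>l\<close> and \<open>L\<close> provide
      admissible constants below them, even if the infima \<open>?c\<close> and \<open>?K\<close>
      are not attained or are 0.\<close>
    have M_le: "?M \<le> ereal (l * max 1 (L / s))"
      if less: "?c < ereal l" "?K < ereal L" and s: "s > 0" "ereal s < ?S" for l L s
    proof -
      obtain l' where l': "l' > 0" "calm_above_with max_dist (\<lambda>z. ereal (\<theta> z)) (pb, xb) l'" "l' < l"
        using less(1) by (auto simp: clm_above_def INF_less_iff)
      obtain L' where L': "L' > 0" "lip_usc_with (\<lambda>p. F (p, xb)) pb L'" "L' < L"
        using less(2) by (auto simp: Lipusc_def INF_less_iff)
      have "?M \<le> ereal (l' * max 1 (L' / s))"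
        unfolding clm_above_def using calm[OF l'(1,2) L'(1,2) s] l'(1)
        by (intro INF_lower) (auto intro!: mult_pos_pos)
      also have "l' * max 1 (L' / s) \<le> l * max 1 (L / s)"
        using l' L' s(1) by (intro mult_mono max.mono divide_right_mono) auto
      finally show ?thesis by simp
    qed
    have "0 \<le> ?c" "?c \<le> ereal l0"
      using l0 by (auto simp: clm_above_def intro: INF_greatest INF_lower)
    then obtain c where c: "?c = ereal c" "c \<ge> 0" by (cases ?c) auto
    have "0 \<le> ?K" "?K \<le> ereal L0"
      using L0 by (auto simp: Lipusc_def intro: INF_greatest INF_lower)
    then obtain K where K: "?K = ereal K" "K \<ge> 0" by (cases ?K) auto
    show ?thesis
    proof (cases ?S)
      case (real s)
      with iv have s: "s > 0" by simp
      \<comment> \<open>For a finite outer slope, all three constants are moved by \<open>t\<close>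
        to make the inequalities strict, and \<open>t\<close> tends to 0 from the right.\<close>
      have "((\<lambda>t. ereal ((c + t) * max 1 ((K + t) / (s - t)))) \<longlongrightarrow>
          ereal ((c + 0) * max 1 ((K + 0) / (s - 0)))) (at_right 0)"
        using s by (intro tendsto_intros) auto
      moreover have "\<forall>\<^sub>F t in at_right 0. ?M \<le> ereal ((c + t) * max 1 ((K + t) / (s - t)))"
      proof -
        have "\<forall>\<^sub>F t in at_right (0::real). 0 < t \<and> t < s"
          using s eventually_at_right_field by auto
        then show ?thesis
          by eventually_elim (rule M_le, auto simp: c K real)
      qed
      ultimately have "?M \<le> ereal (c * max 1 (K / s))"
        by (intro tendsto_lowerbound) auto
      also have "ereal (c * max 1 (K / s)) = ?c * max 1 (?K / ?S)"
        using s by (simp add: c K real max_def)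
      finally show ?thesis .
    next
      case PInf
      have "?M \<le> ?c"
      proof (rule ereal_le_epsilon2)
        fix e :: real assume "e > 0"
        \<comment> \<open>Any real slope is admissible here; taking \<open>K + 1\<close> both for
          \<open>L\<close> and for \<open>s\<close> makes the quotient 1, matching the convention
          that \<open>?K / ?S\<close> is 0.\<close>
        then have "?M \<le> ereal ((c + e) * max 1 ((K + 1) / (K + 1)))"
          using c K PInf by (intro M_le) auto
        with K show "?M \<le> ?c + ereal e" by (simp add: c)
      qed
      then show ?thesis by (simp add: PInf K max_def)
    next
      case MInf
      with iv show ?thesis by simp
    qed
  qed
  ultimately show ?thesis by blast
qed

end
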